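(* Let $\Lambda$ be a finite set and let $(g(\lambda)\mid\lambda\in\Lambda)\in\Omega^{\Lambda}$ be a family of monic polynomials; for each $\lambda\in\Lambda$ let $\theta(\lambda)$ be the greatest element of $\mathrm{supp}(g(\lambda))$. Let $Q$ be an ideal of $\Omega$ with $\{g(\lambda)\mid\lambda\in\Lambda\}\subseteq Q$. Then the following six statements are equivalent: (1) $(g(\lambda)\mid\lambda\in\Lambda)$ is a Gröbner basis of $Q$; (2) $Q\cap\delta(\mathbb{N}^{n}\setminus\nabla(\{\theta(\lambda)\mid\lambda\in\Lambda\}))=\{0\}$; (3) for every $f\in Q$ there exists $(p(\lambda)\mid\lambda\in\Lambda)\in\Omega^{\Lambda}$ with $f=\sum_{\lambda\in\Lambda}p(\lambda)g(\lambda)$ and $\mathrm{supp}(p(\lambda))+\mathrm{supp}(g(\lambda))\subseteq\Delta(\mathrm{supp}(f))$ for all $\lambda\in\Lambda$; (4) for every $f\in Q$ and every $\beta\in\max(\mathrm{supp}(f))$ there exists $\xi\in\Lambda$ with $\theta(\xi)\leqslant\beta$ (equivalently: every $h\in\Omega$ for which some $\gamma\in\max(\mathrm{supp}(h))$ satisfies $\theta(\lambda)\not\leqslant\gamma$ for all $\lambda\in\Lambda$ is not in $Q$); (5) for every $f\in Q$ there exists $(p(\lambda)\mid\lambda\in\Lambda)\in\Omega^{\Lambda}$ with $f=\sum_{\lambda\in\Lambda}p(\lambda)g(\lambda)$ and $\deg(p(\lambda))+\deg(g(\lambda))\leqslant\deg(f)$ for all $\lambda\in\Lambda$; (6) for every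 $f\in Q\setminus\{0\}$ and every $\beta\in\mathrm{supp}(f)$ with $\deg(f)=\sum_{i=1}^n\beta_i$ there exists $\xi\in\Lambda$ with $\theta(\xi)\leqslant\beta$ (equivalently: every nonzero $h\in\Omega$ for which some $\gamma\in\mathrm{supp}(h)$ satisfies $\deg(h)=\sum_i\gamma_i$ and $\theta(\lambda)\not\leqslant\gamma$ for all $\lambda\in\Lambda$ is not in $Q$).
   Context: Let $R$ be a commutative ring with identity $1_R$, $n$ a positive integer, $\mathbb{N}=\{0,1,2,\dots\}$, and $\Omega=R[x_1,\dots,x_n]$. For $\alpha,\beta\in\mathbb{N}^n$, $\alpha\leqslant\beta$ means $\alpha_i\leqslant\beta_i$ for all $i$; addition is componentwise. For $f\in\Omega$ and $\alpha\in\mathbb{N}^n$, $f_{[\alpha]}$ denotes the coefficient of $x_1^{\alpha_1}\cdots x_n^{\alpha_n}$ in $f$, $\mathrm{supp}(f)=\{\alpha\in\mathbb{N}^n: f_{[\alpha]}\neq0\}$, and $\deg$ is total degree. For $A,B\subseteq\mathbb{N}^n$: $\Delta(A)=\{\beta:\exists\alpha\in A,\ \beta\leqslant\alpha\}$, $\nabla(A)=\{\beta:\exists\alpha\in A,\ \alpha\leqslant\beta\}$, $\max(A)=\{\beta\in A:\forall\alpha\in A,\ \beta\leqslant\alpha\Rightarrow\beta=\alpha\}$, $A+B=\{\alpha+\beta:\alpha\in A,\beta\in B\}$, and $\delta(A)=\{f\in\Omega:\mathrm{supp}(f)\subseteq A\}$. A polynomial $g\in\Omega$ is monic if $\mathrm{supp}(g)$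 has a greatest element $\theta$ for $\leqslant$ (i.e. $\theta\in\mathrm{supp}(g)$ and $\gamma\leqslant\theta$ for all $\gamma\in\mathrm{supp}(g)$) and $g_{[\theta]}=1_R$. Given a finite set $\Lambda$, a family $(g(\lambda))_{\lambda\in\Lambda}$ of monic polynomials with greatest support elements $\theta(\lambda)$, and an ideal $Q$ containing all $g(\lambda)$, the family is called a Gröbner basis of $Q$ if for every $\tau\in Q\setminus\{0\}$ there exist $\alpha\in\mathrm{supp}(\tau)$ and $r\in\Lambda$ with $\theta(r)\leqslant\alpha$. *)

theory Defs
  imports
    "HOL-Library.Poly_Mapping"
    "HOL-Library.Function_Algebras"
    "HOL-Library.Set_Algebras"
    "HOL-Library.Extended_Real"
begin

(* The polynomial ring is the monoid algebra of N^n over R, with convolution as product.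
   N^n is the type 'n => nat for a finite index type 'n, so that addition and <= are the
   componentwise ones (the order on 'n =>0 nat would be lexicographic).  R ranges over the
   sort {comm_ring, comm_monoid_mult} instead of the class comm_ring_1, because the latter
   excludes the zero ring. *)

type_synonym ('n, 'a) mpoly = "('n \<Rightarrow> nat) \<Rightarrow>\<^sub>0 'a"

abbreviation supp :: "('n, 'a::zero) mpoly \<Rightarrow> ('n \<Rightarrow> nat) set" where
  "supp f \<equiv> Poly_Mapping.keys f"

abbreviation coeff :: "('n, 'a::zero) mpoly \<Rightarrow> ('n \<Rightarrow> nat) \<Rightarrow> 'a" where
  "coeff f \<alpha> \<equiv> Poly_Mapping.lookup f \<alpha>"

definition down_closure :: "('n \<Rightarrow> nat) set \<Rightarrow> ('n \<Rightarrow> nat) set" where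
  "down_closure A = {\<beta>. \<exists>\<alpha>\<in>A. \<beta> \<le> \<alpha>}"

definition up_closure :: "('n \<Rightarrow> nat) set \<Rightarrow> ('n \<Rightarrow> nat) set" where
  "up_closure A = {\<beta>. \<exists>\<alpha>\<in>A. \<alpha> \<le> \<beta>}"

definition max_elems :: "('n \<Rightarrow> nat) set \<Rightarrow> ('n \<Rightarrow> nat) set" where
  "max_elems A = {\<beta>\<in>A. \<forall>\<alpha>\<in>A. \<beta> \<le> \<alpha> \<longrightarrow> \<beta> = \<alpha>}"

definition supported_on :: "('n \<Rightarrow> nat) set \<Rightarrow> ('n, 'a::zero) mpoly set" where
  "supported_on A = {f. supp f \<subseteq> A}"

definition exp_sum :: "('n::finite \<Rightarrow> nat) \<Rightarrow> nat" where
  "exp_sum \<alpha> = (\<Sum>i\<in>UNIV. \<alpha> i)"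

(* The zero polynomial has degree -infinity. *)
definition total_degree :: "('n::finite, 'a::zero) mpoly \<Rightarrow> ereal" where
  "total_degree f = (if f = 0 then -\<infinity> else ereal (real (Max (exp_sum ` supp f))))"

definition monic :: "('n, 'a::{zero,one}) mpoly \<Rightarrow> bool" where
  "monic g \<longleftrightarrow> (\<exists>\<theta>\<in>supp g. (\<forall>\<gamma>\<in>supp g. \<gamma> \<le> \<theta>) \<and> coeff g \<theta> = 1)"

(* Meaningful only if the support has a greatest element, e.g. for monic g. *)
definition lead_exp :: "('n, 'a::zero) mpoly \<Rightarrow> ('n \<Rightarrow> nat)" where
  "lead_exp g = (GREATEST \<alpha>. \<alpha> \<in> supp g)"

definition is_ideal :: "'b::comm_ring set \<Rightarrow> bool" where
  "is_ideal Q \<longleftrightarrow> 0 \<in> Q \<and> (\<forall>a\<in>Q. \<forall>b\<in>Q. a - b \<in> Q) \<and> (\<forall>r. \<forall>a\<in>Q. r * a \<in> Q)"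

(* Used for a finite family of monic polynomials lying in the ideal Q. *)
definition groebner_basis ::
    "'l set \<Rightarrow> ('l \<Rightarrow> ('n, 'a::zero) mpoly) \<Rightarrow> ('n, 'a) mpoly set \<Rightarrow> bool" where
  "groebner_basis \<Lambda> g Q \<longleftrightarrow>
     (\<forall>\<tau>\<in>Q - {0}. \<exists>\<alpha>\<in>supp \<tau>. \<exists>r\<in>\<Lambda>. lead_exp (g r) \<le> \<alpha>)"

lemma lead_exp_greatest:
  assumes "monic g"
  shows "lead_exp g \<in> supp g" and "\<gamma> \<in> supp g \<Longrightarrow> \<gamma> \<le> lead_exp g"
    and "coeff g (lead_exp g) = 1"
proof -
  from assms obtain \<theta> where *: "\<theta> \<in> supp g" "\<And>\<gamma>. \<gamma> \<in> supp g \<Longrightarrow> \<gamma> \<le> \<theta>" "coeff g \<theta> = 1"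
    unfolding monic_def by blast
  have "lead_exp g = \<theta>"
    unfolding lead_exp_def by (rule Greatest_equality) (use * in auto)
  with * show "lead_exp g \<in> supp g" and "\<gamma> \<in> supp g \<Longrightarrow> \<gamma> \<le> lead_exp g"
    and "coeff g (lead_exp g) = 1" by auto
qed

end

theory Submission
  imports Defs
begin

text \<open>
  Dividing f by the monic family, never leaving the finite order ideal generated by the support
  of f, gives f as a combination of the g l plus a remainder that no leading exponent divides
  (induction on the total degree of a single monomial).  If f lies in Q, so does the remainder,
  and the basis property makes it vanish; this yields the representations (3) and (5).
  Conversely, in such a representation an extremal exponent of f can only be produced by the
  leading exponent of some g l.
\<close>

section \<open>Exponent sums and total degree\<close>

lemma exp_sum_plus: "exp_sum (\<alpha> + \<beta>) = exp_sum \<alpha> + exp_sum \<beta>"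
  by (simp add: exp_sum_def sum.distrib)

lemma exp_sum_mono: "\<alpha> \<le> \<beta> \<Longrightarrow> exp_sum \<alpha> \<le> exp_sum \<beta>"
  by (auto simp: exp_sum_def le_fun_def intro: sum_mono)

text \<open>Some coordinate increases strictly and none decreases. This makes \<open>exp_sum\<close>
  a termination measure for division and forces comparable exponents of equal degree to
  coincide.\<close>

lemma exp_sum_strict_mono:
  assumes "\<alpha> \<le> \<beta>" "\<alpha> \<noteq> \<beta>"
  shows "exp_sum \<alpha> < exp_sum \<beta>"
proof -
  from assms obtain i where "\<alpha> i < \<beta> i"
    by (metis ext le_fun_def le_neq_implies_less)
  with assms(1) show ?thesis
    unfolding exp_sum_def by (intro sum_strict_mono_ex1) (auto simp: le_fun_def)
qed

lemma exp_sum_le_total_degree: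
  "\<alpha> \<in> supp f \<Longrightarrow> ereal (real (exp_sum \<alpha>)) \<le> total_degree f"
  by (auto simp: total_degree_def)

lemma obtain_total_degree:
  assumes "f \<noteq> 0"
  obtains \<alpha> where "\<alpha> \<in> supp f" "total_degree f = ereal (real (exp_sum \<alpha>))"
proof -
  have "Max (exp_sum ` supp f) \<in> exp_sum ` supp f"
    using assms by (intro Max_in) auto
  then obtain \<alpha> where "\<alpha> \<in> supp f" "Max (exp_sum ` supp f) = exp_sum \<alpha>"
    by (rule imageE)
  with assms show ?thesis by (intro that) (simp_all add: total_degree_def)
qed

text \<open>As \<open>exp_sum\<close> is monotone, the greatest exponent for the componentwise order
  also has the greatest coordinate sum.\<close>

lemma total_degree_monic:
  assumes "monic g"
  shows "total_degree g = ereal (real (exp_sum (lead_exp g)))"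
proof -
  have "g \<noteq> 0" using lead_exp_greatest(1)[OF assms] by auto
  then obtain \<alpha> where "\<alpha> \<in> supp g" "total_degree g = ereal (real (exp_sum \<alpha>))"
    by (rule obtain_total_degree)
  with exp_sum_mono[OF lead_exp_greatest(2)[OF assms]]
    exp_sum_le_total_degree[OF lead_exp_greatest(1)[OF assms]]
  show ?thesis by fastforce
qed

text \<open>Passes from the support bound to the degree bound: exponents of top degree in
  \<open>p\<close> and in \<open>g\<close> add up to an exponent that lies below some exponent of
  \<open>f\<close>. The sumset of the supports is immune to cancellation in \<open>p * g\<close>, so
  zero divisors do no harm.\<close>

lemma total_degree_add_le:
  fixes p g f :: "('n::finite, 'a::zero) mpoly"
  assumes g: "g \<noteq> 0" and sub: "supp p + supp g \<subseteq> down_closure (supp f)"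
  shows "total_degree p + total_degree g \<le> total_degree f"
proof (cases "p = 0")
  case True
  \<comment> \<open>Here \<open>total_degree p\<close> is minus infinity, which absorbs the finite
    degree of \<open>g\<close>.\<close>
  obtain \<gamma> where "\<gamma> \<in> supp g" "total_degree g = ereal (real (exp_sum \<gamma>))"
    using g by (rule obtain_total_degree)
  with True show ?thesis by (simp add: total_degree_def)
next
  case False
  obtain \<alpha> \<gamma> where \<alpha>: "\<alpha> \<in> supp p" "total_degree p = ereal (real (exp_sum \<alpha>))"
    and \<gamma>: "\<gamma> \<in> supp g" "total_degree g = ereal (real (exp_sum \<gamma>))"
    using False g obtain_total_degree by metis
  obtain \<delta> where \<delta>: "\<delta> \<in> supp f" "\<alpha> + \<gamma> \<le> \<delta>"
    using sub set_plus_intro[OF \<alpha>(1) \<gamma>(1)] by (auto simp: down_closure_def)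
  have "total_degree p + total_degree g = ereal (real (exp_sum (\<alpha> + \<gamma>)))"
    by (simp add: \<alpha> \<gamma> exp_sum_plus)
  also have "\<dots> \<le> ereal (real (exp_sum \<delta>))"
    using exp_sum_mono[OF \<delta>(2)] by simp
  also have "\<dots> \<le> total_degree f"
    using \<delta>(1) by (rule exp_sum_le_total_degree)
  finally show ?thesis .
qed

section \<open>Supports of combinations and monomial expansion\<close>

text \<open>Cancellation can only remove exponents, so each one that survives stems from a pair of
  exponents in a single product.\<close>

lemma supp_sum_mult:
  fixes p g :: "'l \<Rightarrow> ('n, 'a::semiring_0) mpoly"
  assumes "\<beta> \<in> supp (\<Sum>l\<in>\<Lambda>. p l * g l)"
  obtains l \<alpha> \<gamma> where "l \<in> \<Lambda>" "\<alpha> \<in> supp (p l)" "\<gamma> \<in> supp (g l)" "\<beta> = \<alpha> + \<gamma>"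
proof -
  have "\<beta> \<in> (\<Union>l\<in>\<Lambda>. supp (p l * g l))"
    using subsetD[OF keys_sum assms] .
  then obtain l where l: "l \<in> \<Lambda>" "\<beta> \<in> supp (p l * g l)"
    by (rule UN_E)
  from subsetD[OF keys_mult l(2)] obtain \<alpha> \<gamma>
    where "\<beta> = \<alpha> + \<gamma>" "\<alpha> \<in> supp (p l)" "\<gamma> \<in> supp (g l)"
    by auto
  with l(1) show ?thesis by (intro that)
qed

lemma sum_single_lookup:
  "(\<Sum>\<beta>\<in>Poly_Mapping.keys h. Poly_Mapping.single \<beta> (Poly_Mapping.lookup h \<beta>)) = h"
proof (rule poly_mapping_eqI)
  fix k
  show "Poly_Mapping.lookup
      (\<Sum>\<beta>\<in>Poly_Mapping.keys h. Poly_Mapping.single \<beta> (Poly_Mapping.lookup h \<beta>)) k =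
      Poly_Mapping.lookup h k"
    by (simp add: lookup_sum lookup_single when_def in_keys_iff)
qed

section \<open>Division by a family of monic polynomials\<close>

text \<open>Since the leading coefficient is 1, a monomial multiple of \<open>g\<close> cancels the
  given monomial over any ring. The other exponents of \<open>g\<close> lie strictly below
  \<open>lead_exp g\<close>, and translation by \<open>\<alpha> - lead_exp g\<close> keeps them
  strictly below \<open>\<alpha>\<close>.\<close>

lemma monic_division_step:
  fixes g :: "('n, 'a::{comm_ring,comm_monoid_mult}) mpoly"
  assumes g: "monic g" and le: "lead_exp g \<le> \<alpha>"
  obtains h where "Poly_Mapping.single \<alpha> c = Poly_Mapping.single (\<alpha> - lead_exp g) c * g + h"
    "\<forall>\<beta>\<in>supp h. \<beta> \<le> \<alpha> \<and> \<beta> \<noteq> \<alpha>"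
proof -
  let ?\<theta> = "lead_exp g" and ?m = "Poly_Mapping.single (\<alpha> - lead_exp g)"
  define g' where "g' = g - Poly_Mapping.single ?\<theta> 1"
  \<comment> \<open>Subtraction of exponents is truncated in each coordinate; \<open>le\<close>
    makes it exact.\<close>
  have \<alpha>: "\<alpha> - ?\<theta> + ?\<theta> = \<alpha>"
    using le by (auto simp: le_fun_def)
  have "Poly_Mapping.single \<alpha> c = ?m c * Poly_Mapping.single ?\<theta> 1"
    by (simp add: mult_single \<alpha>)
  also have "\<dots> = ?m c * g + - (?m c * g')"
    by (simp add: g'_def algebra_simps)
  finally have eq: "Poly_Mapping.single \<alpha> c = ?m c * g + - (?m c * g')" .
  have less: "\<beta> \<le> \<alpha> \<and> \<beta> \<noteq> \<alpha>" if "\<beta> \<in> supp (- (?m c * g'))" for \<beta>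
  proof -
    from that have "\<beta> \<in> supp (?m c * g')"
      by (simp add: in_keys_iff)
    then obtain \<gamma> where \<beta>: "\<beta> = \<alpha> - ?\<theta> + \<gamma>" and "\<gamma> \<in> supp g'"
      using keys_mult[of "?m c" g'] by (auto split: if_splits)
    \<comment> \<open>At \<open>?\<theta>\<close> the coefficient of \<open>g'\<close> is 1 - 1 = 0;
      elsewhere \<open>g'\<close> agrees with \<open>g\<close>.\<close>
    then have "\<gamma> \<in> supp g" "\<gamma> \<noteq> ?\<theta>"
      using lead_exp_greatest(1,3)[OF g]
      by (auto simp: g'_def in_keys_iff lookup_minus lookup_single when_def split: if_splits)
    then have "\<gamma> \<le> ?\<theta>" "\<gamma> \<noteq> ?\<theta>"
      using lead_exp_greatest(2)[OF g] by auto
    then show ?thesis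
      using \<alpha> \<beta> by (metis add_left_cancel add_left_mono)
  qed
  from eq show ?thesis
    by (rule that) (simp add: less del: keys_minus)
qed

text \<open>Rewriting a monomial only introduces smaller exponents, so a set \<open>D\<close> closed
  downwards is never left. Additivity of division reduces the claim to single monomials.\<close>

lemma monic_division:
  fixes g :: "'l \<Rightarrow> ('n::finite, 'a::{comm_ring,comm_monoid_mult}) mpoly"
  assumes \<Lambda>: "finite \<Lambda>" and monic: "\<And>l. l \<in> \<Lambda> \<Longrightarrow> monic (g l)"
    and D: "\<And>\<alpha> \<beta>. \<alpha> \<in> D \<Longrightarrow> \<beta> \<le> \<alpha> \<Longrightarrow> \<beta> \<in> D"
    and f: "supp f \<subseteq> D"
  obtains p r where "f = (\<Sum>l\<in>\<Lambda>. p l * g l) + r"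
    "\<forall>l\<in>\<Lambda>. supp (p l) + supp (g l) \<subseteq> D"
    "supp r \<subseteq> D - up_closure ((\<lambda>l. lead_exp (g l)) ` \<Lambda>)"
proof -
  let ?N = "D - up_closure ((\<lambda>l. lead_exp (g l)) ` \<Lambda>)"
  \<comment> \<open>The bound \<open>D\<close> is the same for all members of \<open>S\<close>,
    which makes \<open>S\<close> closed under addition. The down closure of each polynomial's own
    support would not do, because cancellation may shrink the support of a sum.\<close>
  define S where "S = {f. \<exists>p r. f = (\<Sum>l\<in>\<Lambda>. p l * g l) + r \<and>
    (\<forall>l\<in>\<Lambda>. supp (p l) + supp (g l) \<subseteq> D) \<and> supp r \<subseteq> ?N}"
  have S_remainder: "r \<in> S" if "supp r \<subseteq> ?N" for r
    unfolding S_def using that by (auto intro!: exI[of _ "\<lambda>_. 0"] exI[of _ r] simp: set_plus_def)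
  have S_mult: "q * g l \<in> S" if "l \<in> \<Lambda>" "supp q + supp (g l) \<subseteq> D" for q l
  proof -
    have "(\<Sum>k\<in>\<Lambda>. (if k = l then q else 0) * g k) = (\<Sum>k\<in>\<Lambda>. if k = l then q * g l else 0)"
      by (rule sum.cong) auto
    also have "\<dots> = q * g l" using \<Lambda> that(1) by simp
    finally show ?thesis
      unfolding S_def using that(2)
      by (intro CollectI exI[of _ "\<lambda>k. if k = l then q else 0"] exI[of _ 0])
        (auto simp: set_plus_def)
  qed
  have S_add: "f + f' \<in> S" if S: "f \<in> S" "f' \<in> S" for f f'
  proof -
    obtain p r p' r' where *: "f = (\<Sum>l\<in>\<Lambda>. p l * g l) + r" "f' = (\<Sum>l\<in>\<Lambda>. p' l * g l) + r'"
      "\<forall>l\<in>\<Lambda>. supp (p l) + supp (g l) \<subseteq> D" "\<forall>l\<in>\<Lambda>. supp (p' l) + supp (g l) \<subseteq> D"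
      "supp r \<subseteq> ?N" "supp r' \<subseteq> ?N"
      using S unfolding S_def by auto
    have "f + f' = (\<Sum>l\<in>\<Lambda>. (p l + p' l) * g l) + (r + r')"
      by (simp only: *(1,2) distrib_right sum.distrib add_ac)
    moreover have "supp (p l + p' l) + supp (g l) \<subseteq> D" if "l \<in> \<Lambda>" for l
    proof -
      have "supp (p l + p' l) + supp (g l) \<subseteq> (supp (p l) \<union> supp (p' l)) + supp (g l)"
        by (intro set_plus_mono2 keys_add order_refl)
      also have "\<dots> = (supp (p l) + supp (g l)) \<union> (supp (p' l) + supp (g l))"
        by (auto simp: set_plus_def)
      also have "\<dots> \<subseteq> D"
        using *(3,4) that by simp
      finally show ?thesis .
    qed
    moreover have "supp (r + r') \<subseteq> ?N"
      using keys_add *(5,6) by (rule order_trans[OF _ Un_least])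
    ultimately show ?thesis
      unfolding S_def by (intro CollectI exI[of _ "\<lambda>l. p l + p' l"] exI[of _ "r + r'"]) simp
  qed
  have S_sum: "h \<in> S" if single: "\<And>\<beta>. \<beta> \<in> supp h \<Longrightarrow> Poly_Mapping.single \<beta> (coeff h \<beta>) \<in> S" for h
  proof -
    \<comment> \<open>The induction runs over subsets \<open>B\<close> of the support while
      \<open>h\<close> stays fixed, so that each added monomial keeps its coefficient in
      \<open>h\<close>.\<close>
    have "(\<Sum>\<beta>\<in>B. Poly_Mapping.single \<beta> (coeff h \<beta>)) \<in> S" if "finite B" "B \<subseteq> supp h" for B
      using that
    proof (induction B rule: finite_induct)
      case empty
      show ?case by (simp add: S_remainder)
    next
      case (insert \<beta> B)
      then show ?case
        using single by (simp add: S_add)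
    qed
    from this[of "supp h"] show ?thesis
      by (simp add: sum_single_lookup)
  qed
  have S_single: "Poly_Mapping.single \<alpha> c \<in> S" if "\<alpha> \<in> D" for \<alpha> c
    using that
  \<comment> \<open>The coefficient \<open>c\<close> is generalized because the smaller monomials
    left by a division step carry other coefficients.\<close>
  proof (induction "exp_sum \<alpha>" arbitrary: \<alpha> c rule: less_induct)
    case less
    show ?case
    proof (cases "\<exists>l\<in>\<Lambda>. lead_exp (g l) \<le> \<alpha>")
      case False
      \<comment> \<open>No leading exponent divides the monomial, so it is its own
        remainder.\<close>
      then show ?thesis
        using less.prems by (intro S_remainder) (auto simp: up_closure_def)
    next
      case True
      then obtain l where l: "l \<in> \<Lambda>" "lead_exp (g l) \<le> \<alpha>" by blast
      let ?m = "Poly_Mapping.single (\<alpha> - lead_exp (g l)) c"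
      obtain h where h: "Poly_Mapping.single \<alpha> c = ?m * g l + h"
        "\<forall>\<beta>\<in>supp h. \<beta> \<le> \<alpha> \<and> \<beta> \<noteq> \<alpha>"
        by (rule monic_division_step[OF monic[OF l(1)] l(2), of c])
      have "h \<in> S"
      proof (rule S_sum)
        fix \<beta> assume "\<beta> \<in> supp h"
        then have "\<beta> \<le> \<alpha>" "\<beta> \<noteq> \<alpha>" using h(2) by blast+
        then show "Poly_Mapping.single \<beta> (coeff h \<beta>) \<in> S"
          by (intro less.hyps exp_sum_strict_mono D[OF less.prems])
      qed
      moreover have "supp ?m + supp (g l) \<subseteq> D"
      proof
        fix \<beta> assume "\<beta> \<in> supp ?m + supp (g l)"
        then obtain \<gamma> where \<gamma>: "\<beta> = \<alpha> - lead_exp (g l) + \<gamma>" "\<gamma> \<in> supp (g l)"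
          by (auto simp: set_plus_def split: if_splits)
        have "\<alpha> - lead_exp (g l) + lead_exp (g l) = \<alpha>"
          using l(2) by (auto simp: le_fun_def)
        \<comment> \<open>Replacing \<open>\<gamma>\<close> by the greatest exponent of
          \<open>g l\<close> can only enlarge the sum, and gives exactly
          \<open>\<alpha>\<close>.\<close>
        then have "\<beta> \<le> \<alpha>"
          using \<gamma> lead_exp_greatest(2)[OF monic[OF l(1)]] by (metis add_left_mono)
        with less.prems show "\<beta> \<in> D" by (rule D)
      qed
      ultimately show ?thesis
        unfolding h(1) using l(1) by (intro S_add S_mult)
    qed
  qed
  have "f \<in> S" by (rule S_sum, rule S_single) (use f in blast)
  then obtain p r where pr: "f = (\<Sum>l\<in>\<Lambda>. p l * g l) + r"
      "\<forall>l\<in>\<Lambda>. supp (p l) + supp (g l) \<subseteq> D" "supp r \<subseteq> ?N"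
    unfolding S_def by auto
  show ?thesis
    using pr by (rule that)
qed

section \<open>Ideals and representations from the basis property\<close>

text \<open>\<open>is_ideal\<close> provides closure under subtraction, and
  \<open>a + b = a - (0 - b)\<close>.\<close>

lemma is_ideal_add: "is_ideal Q \<Longrightarrow> a \<in> Q \<Longrightarrow> b \<in> Q \<Longrightarrow> a + b \<in> Q"
  unfolding is_ideal_def by (metis diff_0 diff_minus_eq_add)

lemma is_ideal_sum_mult:
  assumes Q: "is_ideal Q" and g: "g ` \<Lambda> \<subseteq> Q"
  shows "(\<Sum>l\<in>\<Lambda>. p l * g l) \<in> Q"
  using g
proof (induction \<Lambda> rule: infinite_finite_induct)
  case (insert l \<Lambda>)
  then have "p l * g l \<in> Q" using Q by (auto simp: is_ideal_def)
  with insert show ?case using is_ideal_add[OF Q] by simp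
qed (use Q in \<open>auto simp: is_ideal_def\<close>)

text \<open>For each single \<open>\<tau>\<close>, lying in \<open>supported_on\<close> of the
  complement is the negation of having an exponent above a leading exponent.\<close>

lemma groebner_basis_iff_supported_on:
  assumes "0 \<in> Q"
  shows "groebner_basis \<Lambda> g Q \<longleftrightarrow>
    Q \<inter> supported_on (UNIV - up_closure ((\<lambda>l. lead_exp (g l)) ` \<Lambda>)) = {0}"
proof -
  have "groebner_basis \<Lambda> g Q \<longleftrightarrow>
      (\<forall>\<tau>\<in>Q - {0}. \<tau> \<notin> supported_on (UNIV - up_closure ((\<lambda>l. lead_exp (g l)) ` \<Lambda>)))"
    by (auto simp: groebner_basis_def supported_on_def up_closure_def)
  moreover have "0 \<in> supported_on (UNIV - up_closure ((\<lambda>l. lead_exp (g l)) ` \<Lambda>))"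
    by (simp add: supported_on_def)
  ultimately show ?thesis using assms by blast
qed

text \<open>Division is applied with \<open>D\<close> the down closure of \<open>supp f\<close>. The
  remainder lies in \<open>Q\<close> and avoids all multiples of leading exponents, so the basis
  property kills it.\<close>

lemma groebner_basis_representation:
  fixes g :: "'l \<Rightarrow> ('n::finite, 'a::{comm_ring,comm_monoid_mult}) mpoly"
  assumes \<Lambda>: "finite \<Lambda>" and monic: "\<And>l. l \<in> \<Lambda> \<Longrightarrow> monic (g l)"
    and Q: "is_ideal Q" "g ` \<Lambda> \<subseteq> Q"
    and gb: "groebner_basis \<Lambda> g Q" and f: "f \<in> Q"
  obtains p where "f = (\<Sum>l\<in>\<Lambda>. p l * g l)"
    "\<forall>l\<in>\<Lambda>. supp (p l) + supp (g l) \<subseteq> down_closure (supp f)"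
proof -
  obtain p r where *: "f = (\<Sum>l\<in>\<Lambda>. p l * g l) + r"
    "\<forall>l\<in>\<Lambda>. supp (p l) + supp (g l) \<subseteq> down_closure (supp f)"
    "supp r \<subseteq> down_closure (supp f) - up_closure ((\<lambda>l. lead_exp (g l)) ` \<Lambda>)"
  proof (rule monic_division[OF \<Lambda> monic])
    show "supp f \<subseteq> down_closure (supp f)"
      by (auto simp: down_closure_def)
    show "\<beta> \<in> down_closure (supp f)" if "\<alpha> \<in> down_closure (supp f)" "\<beta> \<le> \<alpha>" for \<alpha> \<beta>
      using that by (auto simp: down_closure_def intro: order_trans)
  qed
  have "f - (\<Sum>l\<in>\<Lambda>. p l * g l) \<in> Q"
    using Q(1) f is_ideal_sum_mult[OF Q] unfolding is_ideal_def by blast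
  then have "r \<in> Q" by (simp add: *(1))
  moreover have "r \<in> supported_on (UNIV - up_closure ((\<lambda>l. lead_exp (g l)) ` \<Lambda>))"
    using *(3) by (auto simp: supported_on_def)
  moreover have "0 \<in> Q" using Q(1) by (simp add: is_ideal_def)
  ultimately have "r = 0"
    using gb groebner_basis_iff_supported_on by blast
  then show ?thesis using that[of p] *(1,2) by simp
qed

section \<open>Extremal exponents of a represented polynomial\<close>

text \<open>Write \<open>\<beta> = \<alpha> + \<gamma>\<close> with exponents of \<open>p l\<close>
  and \<open>g l\<close>. Then \<open>\<alpha> + \<theta> l\<close> lies above
  \<open>\<beta>\<close> and, by the support bound, below some exponent of \<open>f\<close>;
  maximality of \<open>\<beta>\<close> collapses this chain.\<close>

lemma max_elems_lead_exp:
  fixes p g :: "'l \<Rightarrow> ('n, 'a::semiring_0) mpoly"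
  assumes f: "f = (\<Sum>l\<in>\<Lambda>. p l * g l)" "\<beta> \<in> max_elems (supp f)"
    and \<theta>: "\<And>l. l \<in> \<Lambda> \<Longrightarrow> \<theta> l \<in> supp (g l)"
      "\<And>l \<gamma>. l \<in> \<Lambda> \<Longrightarrow> \<gamma> \<in> supp (g l) \<Longrightarrow> \<gamma> \<le> \<theta> l"
    and sub: "\<And>l. l \<in> \<Lambda> \<Longrightarrow> supp (p l) + supp (g l) \<subseteq> down_closure (supp f)"
  shows "\<exists>l\<in>\<Lambda>. \<theta> l \<le> \<beta>"
proof -
  have "\<beta> \<in> supp (\<Sum>l\<in>\<Lambda>. p l * g l)"
    using f by (simp add: max_elems_def)
  then obtain l \<alpha> \<gamma> where l: "l \<in> \<Lambda>" "\<alpha> \<in> supp (p l)" "\<gamma> \<in> supp (g l)" "\<beta> = \<alpha> + \<gamma>"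
    by (rule supp_sum_mult)
  obtain \<delta> where \<delta>: "\<delta> \<in> supp f" "\<alpha> + \<theta> l \<le> \<delta>"
    using sub[OF l(1)] set_plus_intro[OF l(2) \<theta>(1)[OF l(1)]] by (auto simp: down_closure_def)
  have "\<beta> \<le> \<alpha> + \<theta> l"
    using l \<theta>(2) by (simp add: add_left_mono)
  then have "\<beta> = \<alpha> + \<theta> l"
    using \<delta> f(2) by (auto simp: max_elems_def intro: order.antisym)
  then have "\<theta> l \<le> \<beta>" by (simp add: le_fun_def)
  with l(1) show ?thesis by blast
qed

text \<open>With \<open>\<beta> = \<alpha> + \<gamma>\<close> of full degree, the degree bound
  leaves no room for \<open>\<gamma>\<close> to have smaller degree than
  \<open>lead_exp (g l)\<close>; being below it, \<open>\<gamma>\<close> equals it.\<close>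

lemma max_degree_lead_exp:
  fixes p g :: "'l \<Rightarrow> ('n::finite, 'a::{comm_ring,comm_monoid_mult}) mpoly"
  assumes f: "f = (\<Sum>l\<in>\<Lambda>. p l * g l)" "\<beta> \<in> supp f" "total_degree f = ereal (real (exp_sum \<beta>))"
    and monic: "\<And>l. l \<in> \<Lambda> \<Longrightarrow> monic (g l)"
    and deg: "\<And>l. l \<in> \<Lambda> \<Longrightarrow> total_degree (p l) + total_degree (g l) \<le> total_degree f"
  shows "\<exists>l\<in>\<Lambda>. lead_exp (g l) \<le> \<beta>"
proof -
  obtain l \<alpha> \<gamma> where l: "l \<in> \<Lambda>" "\<alpha> \<in> supp (p l)" "\<gamma> \<in> supp (g l)" "\<beta> = \<alpha> + \<gamma>"
    using f(2) unfolding f(1) by (rule supp_sum_mult)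
  have "ereal (real (exp_sum \<alpha>)) + ereal (real (exp_sum (lead_exp (g l))))
      \<le> total_degree (p l) + total_degree (g l)"
    using l monic by (intro add_mono) (auto simp: total_degree_monic exp_sum_le_total_degree)
  also have "\<dots> \<le> ereal (real (exp_sum \<beta>))"
    using deg[OF l(1)] f(3) by simp
  finally have "exp_sum (lead_exp (g l)) \<le> exp_sum \<gamma>"
    by (simp add: l(4) exp_sum_plus)
  moreover have "\<gamma> \<le> lead_exp (g l)"
    using l monic lead_exp_greatest(2) by blast
  ultimately have "\<gamma> = lead_exp (g l)"
    using exp_sum_strict_mono by fastforce
  then have "lead_exp (g l) \<le> \<beta>" by (simp add: l(4) le_fun_def)
  with l(1) show ?thesis by blast
qed

text \<open>A strictly larger exponent in the support would exceed the total degree.\<close>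

lemma max_elems_if_total_degree:
  assumes "\<beta> \<in> supp f" "total_degree f = ereal (real (exp_sum \<beta>))"
  shows "\<beta> \<in> max_elems (supp f)"
proof -
  have "\<beta> = \<alpha>" if "\<alpha> \<in> supp f" "\<beta> \<le> \<alpha>" for \<alpha>
    using exp_sum_le_total_degree[OF that(1)] exp_sum_strict_mono[OF that(2)] assms(2) by fastforce
  with assms(1) show ?thesis by (simp add: max_elems_def)
qed

section \<open>The equivalences\<close>

theorem theorem3p1:
  fixes \<Lambda> :: "'l set"
    and g :: "'l \<Rightarrow> ('n::finite, 'a::{comm_ring,comm_monoid_mult}) mpoly"
    and \<theta> :: "'l \<Rightarrow> ('n \<Rightarrow> nat)"
    and Q :: "('n, 'a) mpoly set"
  assumes "finite \<Lambda>"
    and "\<And>l. l \<in> \<Lambda> \<Longrightarrow> monic (g l)"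
    and "\<And>l. l \<in> \<Lambda> \<Longrightarrow> \<theta> l = lead_exp (g l)"
    and "is_ideal Q"
    and "g ` \<Lambda> \<subseteq> Q"
  shows
    "(groebner_basis \<Lambda> g Q \<longleftrightarrow> Q \<inter> supported_on (UNIV - up_closure (\<theta> ` \<Lambda>)) = {0}) \<and>
     (groebner_basis \<Lambda> g Q \<longleftrightarrow>
       (\<forall>f\<in>Q. \<exists>p :: 'l \<Rightarrow> ('n, 'a) mpoly.
          f = (\<Sum>l\<in>\<Lambda>. p l * g l) \<and>
          (\<forall>l\<in>\<Lambda>. supp (p l) + supp (g l) \<subseteq> down_closure (supp f)))) \<and>
     (groebner_basis \<Lambda> g Q \<longleftrightarrow>
       (\<forall>f\<in>Q. \<forall>\<beta>\<in>max_elems (supp f). \<exists>l\<in>\<Lambda>. \<theta> l \<le> \<beta>)) \<and>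
     (groebner_basis \<Lambda> g Q \<longleftrightarrow>
       (\<forall>h. (\<exists>\<gamma>\<in>max_elems (supp h). \<forall>l\<in>\<Lambda>. \<not> \<theta> l \<le> \<gamma>) \<longrightarrow> h \<notin> Q)) \<and>
     (groebner_basis \<Lambda> g Q \<longleftrightarrow>
       (\<forall>f\<in>Q. \<exists>p :: 'l \<Rightarrow> ('n, 'a) mpoly.
          f = (\<Sum>l\<in>\<Lambda>. p l * g l) \<and>
          (\<forall>l\<in>\<Lambda>. total_degree (p l) + total_degree (g l) \<le> total_degree f))) \<and>
     (groebner_basis \<Lambda> g Q \<longleftrightarrow>
       (\<forall>f\<in>Q - {0}. \<forall>\<beta>\<in>supp f.
          total_degree f = ereal (real (exp_sum \<beta>)) \<longrightarrow> (\<exists>l\<in>\<Lambda>. \<theta> l \<le> \<beta>))) \<and>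
     (groebner_basis \<Lambda> g Q \<longleftrightarrow>
       (\<forall>h. h \<noteq> 0 \<and>
          (\<exists>\<gamma>\<in>supp h. total_degree h = ereal (real (exp_sum \<gamma>)) \<and> (\<forall>l\<in>\<Lambda>. \<not> \<theta> l \<le> \<gamma>))
          \<longrightarrow> h \<notin> Q))"
proof -
  \<comment> \<open>\<open>\<theta>\<close> is tied to the leading exponents only on
    \<open>\<Lambda>\<close>, so the images are compared rather than the functions.\<close>
  have \<theta>_image: "\<theta> ` \<Lambda> = (\<lambda>l. lead_exp (g l)) ` \<Lambda>"
    using assms(3) by auto
  let ?gb = "groebner_basis \<Lambda> g Q"
  let ?s3 = "\<forall>f\<in>Q. \<exists>p :: 'l \<Rightarrow> ('n, 'a) mpoly. f = (\<Sum>l\<in>\<Lambda>. p l * g l) \<and>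
    (\<forall>l\<in>\<Lambda>. supp (p l) + supp (g l) \<subseteq> down_closure (supp f))"
  let ?s4 = "\<forall>f\<in>Q. \<forall>\<beta>\<in>max_elems (supp f). \<exists>l\<in>\<Lambda>. \<theta> l \<le> \<beta>"
  let ?s5 = "\<forall>f\<in>Q. \<exists>p :: 'l \<Rightarrow> ('n, 'a) mpoly. f = (\<Sum>l\<in>\<Lambda>. p l * g l) \<and>
    (\<forall>l\<in>\<Lambda>. total_degree (p l) + total_degree (g l) \<le> total_degree f)"
  let ?s6 = "\<forall>f\<in>Q - {0}. \<forall>\<beta>\<in>supp f. total_degree f = ereal (real (exp_sum \<beta>)) \<longrightarrow>
    (\<exists>l\<in>\<Lambda>. \<theta> l \<le> \<beta>)"
  have s2: "?gb \<longleftrightarrow> Q \<inter> supported_on (UNIV - up_closure (\<theta> ` \<Lambda>)) = {0}"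
    unfolding \<theta>_image using assms(4) by (intro groebner_basis_iff_supported_on) (simp add: is_ideal_def)
  have gb_s3: ?s3 if gb: ?gb
  proof
    fix f assume "f \<in> Q"
    obtain p where "f = (\<Sum>l\<in>\<Lambda>. p l * g l)"
      "\<forall>l\<in>\<Lambda>. supp (p l) + supp (g l) \<subseteq> down_closure (supp f)"
      by (rule groebner_basis_representation[OF assms(1,2,4,5) gb \<open>f \<in> Q\<close>])
    then show "\<exists>p :: 'l \<Rightarrow> ('n, 'a) mpoly. f = (\<Sum>l\<in>\<Lambda>. p l * g l) \<and>
        (\<forall>l\<in>\<Lambda>. supp (p l) + supp (g l) \<subseteq> down_closure (supp f))"
      by blast
  qed
  have s3_s4: ?s4 if ?s3
  proof (intro ballI)
    fix f \<beta> assume f: "f \<in> Q" and \<beta>: "\<beta> \<in> max_elems (supp f)"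
    from that f obtain p :: "'l \<Rightarrow> ('n, 'a) mpoly" where p: "f = (\<Sum>l\<in>\<Lambda>. p l * g l)"
      "\<forall>l\<in>\<Lambda>. supp (p l) + supp (g l) \<subseteq> down_closure (supp f)" by blast
    show "\<exists>l\<in>\<Lambda>. \<theta> l \<le> \<beta>"
      using max_elems_lead_exp[OF p(1) \<beta>, of \<theta>] p(2) assms(2,3) lead_exp_greatest(1,2)
      by metis
  qed
  have s3_s5: ?s5 if ?s3
  proof
    fix f assume "f \<in> Q"
    with that obtain p :: "'l \<Rightarrow> ('n, 'a) mpoly" where p: "f = (\<Sum>l\<in>\<Lambda>. p l * g l)"
      "\<forall>l\<in>\<Lambda>. supp (p l) + supp (g l) \<subseteq> down_closure (supp f)" by blast
    have "g l \<noteq> 0" if "l \<in> \<Lambda>" for l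
      using assms(2)[OF that] by (auto simp: monic_def)
    with p show "\<exists>p :: 'l \<Rightarrow> ('n, 'a) mpoly. f = (\<Sum>l\<in>\<Lambda>. p l * g l) \<and>
        (\<forall>l\<in>\<Lambda>. total_degree (p l) + total_degree (g l) \<le> total_degree f)"
      using total_degree_add_le by blast
  qed
  have s4_s6: ?s6 if ?s4
    using that max_elems_if_total_degree by blast
  have s5_s6: ?s6 if ?s5
  proof (intro ballI impI)
    fix f \<beta> assume f: "f \<in> Q - {0}" and \<beta>: "\<beta> \<in> supp f" "total_degree f = ereal (real (exp_sum \<beta>))"
    from that f obtain p :: "'l \<Rightarrow> ('n, 'a) mpoly" where p: "f = (\<Sum>l\<in>\<Lambda>. p l * g l)"
      "\<forall>l\<in>\<Lambda>. total_degree (p l) + total_degree (g l) \<le> total_degree f" by blast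
    show "\<exists>l\<in>\<Lambda>. \<theta> l \<le> \<beta>"
      using max_degree_lead_exp[OF p(1) \<beta>] p(2) assms(2,3) by auto
  qed
  have s6_gb: ?gb if ?s6
    unfolding groebner_basis_def
  proof
    fix \<tau> assume \<tau>: "\<tau> \<in> Q - {0}"
    \<comment> \<open>A nonzero polynomial attains its degree at some exponent, and this one serves
      as the witness.\<close>
    then obtain \<beta> where \<beta>: "\<beta> \<in> supp \<tau>" "total_degree \<tau> = ereal (real (exp_sum \<beta>))"
      using obtain_total_degree by blast
    with \<tau> that obtain l where "l \<in> \<Lambda>" "\<theta> l \<le> \<beta>" by blast
    with \<beta>(1) assms(3) show "\<exists>\<alpha>\<in>supp \<tau>. \<exists>l\<in>\<Lambda>. lead_exp (g l) \<le> \<alpha>" by auto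
  qed
  \<comment> \<open>Two cycles of implications are now closed: \<open>?gb\<close>,
    \<open>?s3\<close>, \<open>?s4\<close>, \<open>?s6\<close> and \<open>?gb\<close>,
    \<open>?s3\<close>, \<open>?s5\<close>, \<open>?s6\<close>.\<close>
  have s3: "?gb \<longleftrightarrow> ?s3" using gb_s3 s3_s4 s4_s6 s6_gb by argo
  have s4: "?gb \<longleftrightarrow> ?s4" using gb_s3 s3_s4 s4_s6 s6_gb by argo
  have s5: "?gb \<longleftrightarrow> ?s5" using gb_s3 s3_s5 s5_s6 s6_gb by argo
  have s6: "?gb \<longleftrightarrow> ?s6" using gb_s3 s3_s4 s4_s6 s6_gb by argo
  have s4': "?gb \<longleftrightarrow>
      (\<forall>h. (\<exists>\<gamma>\<in>max_elems (supp h). \<forall>l\<in>\<Lambda>. \<not> \<theta> l \<le> \<gamma>) \<longrightarrow> h \<notin> Q)"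
    unfolding s4 by blast
  have s6': "?gb \<longleftrightarrow>
      (\<forall>h. h \<noteq> 0 \<and>
        (\<exists>\<gamma>\<in>supp h. total_degree h = ereal (real (exp_sum \<gamma>)) \<and> (\<forall>l\<in>\<Lambda>. \<not> \<theta> l \<le> \<gamma>))
        \<longrightarrow> h \<notin> Q)"
    unfolding s6 by blast
  show ?thesis
    by (intro conjI) (fact s2 s3 s4 s4' s5 s6 s6')+
qed

end
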